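(* Let $k,\ell$ be integers and let $I=(p,\varpi,\rho_0,\dots,\rho_q)$ be a general interpretation scheme of $\lambda$-structures in $\beta_{k,\ell}$-structures defined by quantifier-free formulas, such that there exists an integer $N$ with the property that for every $\mathbf B\in\mathcal B_{k,\ell}$ and every $(v_1,\dots,v_p)\in B^p$, the $\varpi$-equivalence class of $(v_1,\dots,v_p)$ has cardinality at most $N$. Then there exists a quantifier-free formula $\hat\rho_0$ with $p$ free variables such that the (ordinary) QF-interpretation scheme $\hat I=(p,\hat\rho_0,\rho_1,\dots,\rho_q)$ of $\lambda$-structures in $\beta_{k,\ell}$-structures satisfies: for every $\mathbf B\in\mathcal B_{k,\ell}$, the $\lambda$-structures $I(\mathbf B)$ and $\hat I(\mathbf B)$ are isomorphic.
   Context: A signature is a finite set of relation symbols with arities; a structure has a finite domain and relations of the prescribed arities; formulas are first-order with equality. Ordinary interpretation scheme: if $\lambda$ has symbols $R_1,\dots,R_q$ of arities $r_1,\dots,r_q$, $\hat I=(p,\rho_0,\dots,\rho_q)$ with $\rho_0$ a $\kappa$-formula with $p$ free variables and $\rho_i$ a $\kappa$-formula with $pr_i$ free variables; $\hat I(\mathbf A)$ has domain $\{\mathbf v\in A^p:\mathbf A\models\rho_0(\mathbf v)\}$ and $R_i(\mathbf v_1,\dots,\mathbf v_{r_i})$ holds iff $\mathbf A\models\rho_i(\mathbf v_1,\dots,\mathbf v_{r_i})$; QF means all formulas quantifier-free. General interpretation scheme $I=(p,\varpi,\rho_0,\dots,\rho_q)$: additionally $\varpi$ is a $\kappa$-formula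 with $2p$ free variables defining an equivalence relation on $p$-tuples compatible with the $\rho_i$ (i.e. $\bigwedge_{j=1}^{r_i}\varpi(\mathbf x_j,\mathbf y_j)$ entails $\rho_i(\mathbf x_1,\dots,\mathbf x_{r_i})\leftrightarrow\rho_i(\mathbf y_1,\dots,\mathbf y_{r_i})$); $I(\mathbf A)$ has as domain the $\varpi$-classes $[\mathbf x]$ of tuples $\mathbf x\in A^p$ with $\mathbf A\models\rho_0(\mathbf x)$, and $R_i([\mathbf x_1],\dots,[\mathbf x_{r_i}])$ holds iff $\mathbf A\models\rho_i(\mathbf x_1,\dots,\mathbf x_{r_i})$. Strong sum $\mathbf A\oplus\mathbf B$: signature the disjoint union of signatures, domain $A\sqcup B$, each relation holding exactly on the tuples of its own summand on which it holds there. $\mathbf E$: one-element domain with a unary relation true on it. $\mathbf T_M$: domain $\{1,\dots,M\}$ with binary $S$, $S(i,j)\iff i<j$, and unary $U$ true everywhere. $\mathcal B_{k,\ell}$ is the class of structures $\mathbf E\oplus\dots\oplus\mathbf E\oplus\mathbf T_{N_1}\oplus\dots\oplus\mathbf T_{N_k}$ ($\ell$ copies of $\mathbf E$, arbitrary $N_1,\dots,N_k$), and $\beta_{k,\ell}$ is their signature, with relations $U^E_1,\dots,U^E_\ell$ (marking the copies of $\mathbf E$), $U^T_1,\dots,U^T_k$ (marking the tournaments) and $S_1,\dots,S_k$ (the orders of the tournaments). *)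

theory Defs
  imports Main
begin

section \<open>Signatures, structures, first-order formulas\<close>

record 's signature =
  syms :: "'s set"
  ar :: "'s \<Rightarrow> nat"

definition is_signature :: "'s signature \<Rightarrow> bool" where
  "is_signature \<sigma> \<longleftrightarrow> finite (syms \<sigma>)"

record ('s, 'a) struct =
  univ :: "'a set"
  rel :: "'s \<Rightarrow> 'a list set"

definition tuples :: "'a set \<Rightarrow> nat \<Rightarrow> 'a list set" where
  "tuples A n = {v. length v = n \<and> set v \<subseteq> A}"

text \<open>Finite structures; the empty domain is not excluded.\<close>

definition is_struct :: "'s signature \<Rightarrow> ('s, 'a) struct \<Rightarrow> bool" where
  "is_struct \<sigma> A \<longleftrightarrow>
     finite (univ A) \<and> (\<forall>s\<in>syms \<sigma>. rel A s \<subseteq> tuples (univ A) (ar \<sigma> s))"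

definition isomorphic :: "'s signature \<Rightarrow> ('s, 'a) struct \<Rightarrow> ('s, 'b) struct \<Rightarrow> bool" where
  "isomorphic \<sigma> A B \<longleftrightarrow>
     (\<exists>f. bij_betw f (univ A) (univ B) \<and>
          (\<forall>s\<in>syms \<sigma>. \<forall>v\<in>tuples (univ A) (ar \<sigma> s). v \<in> rel A s \<longleftrightarrow> map f v \<in> rel B s))"

datatype 's fm =
    Bot
  | Eq nat nat
  | Rel 's "nat list"
  | Neg "'s fm"
  | Conj "'s fm" "'s fm"
  | Disj "'s fm" "'s fm"
  | Exi nat "'s fm"
  | Uni nat "'s fm"

primrec sat :: "('s, 'a) struct \<Rightarrow> (nat \<Rightarrow> 'a) \<Rightarrow> 's fm \<Rightarrow> bool" where
  "sat A e Bot \<longleftrightarrow> False"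
| "sat A e (Eq i j) \<longleftrightarrow> e i = e j"
| "sat A e (Rel s is) \<longleftrightarrow> map e is \<in> rel A s"
| "sat A e (Neg \<phi>) \<longleftrightarrow> \<not> sat A e \<phi>"
| "sat A e (Conj \<phi> \<psi>) \<longleftrightarrow> sat A e \<phi> \<and> sat A e \<psi>"
| "sat A e (Disj \<phi> \<psi>) \<longleftrightarrow> sat A e \<phi> \<or> sat A e \<psi>"
| "sat A e (Exi i \<phi>) \<longleftrightarrow> (\<exists>a\<in>univ A. sat A (e(i := a)) \<phi>)"
| "sat A e (Uni i \<phi>) \<longleftrightarrow> (\<forall>a\<in>univ A. sat A (e(i := a)) \<phi>)"

primrec fv :: "'s fm \<Rightarrow> nat set" where
  "fv Bot = {}"
| "fv (Eq i j) = {i, j}"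
| "fv (Rel s is) = set is"
| "fv (Neg \<phi>) = fv \<phi>"
| "fv (Conj \<phi> \<psi>) = fv \<phi> \<union> fv \<psi>"
| "fv (Disj \<phi> \<psi>) = fv \<phi> \<union> fv \<psi>"
| "fv (Exi i \<phi>) = fv \<phi> - {i}"
| "fv (Uni i \<phi>) = fv \<phi> - {i}"

primrec over :: "'s signature \<Rightarrow> 's fm \<Rightarrow> bool" where
  "over \<sigma> Bot \<longleftrightarrow> True"
| "over \<sigma> (Eq i j) \<longleftrightarrow> True"
| "over \<sigma> (Rel s is) \<longleftrightarrow> s \<in> syms \<sigma> \<and> length is = ar \<sigma> s"
| "over \<sigma> (Neg \<phi>) \<longleftrightarrow> over \<sigma> \<phi>"
| "over \<sigma> (Conj \<phi> \<psi>) \<longleftrightarrow> over \<sigma> \<phi> \<and> over \<sigma> \<psi>"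
| "over \<sigma> (Disj \<phi> \<psi>) \<longleftrightarrow> over \<sigma> \<phi> \<and> over \<sigma> \<psi>"
| "over \<sigma> (Exi i \<phi>) \<longleftrightarrow> over \<sigma> \<phi>"
| "over \<sigma> (Uni i \<phi>) \<longleftrightarrow> over \<sigma> \<phi>"

primrec qf :: "'s fm \<Rightarrow> bool" where
  "qf Bot \<longleftrightarrow> True"
| "qf (Eq i j) \<longleftrightarrow> True"
| "qf (Rel s is) \<longleftrightarrow> True"
| "qf (Neg \<phi>) \<longleftrightarrow> qf \<phi>"
| "qf (Conj \<phi> \<psi>) \<longleftrightarrow> qf \<phi> \<and> qf \<psi>"
| "qf (Disj \<phi> \<psi>) \<longleftrightarrow> qf \<phi> \<and> qf \<psi>"
| "qf (Exi i \<phi>) \<longleftrightarrow> False"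
| "qf (Uni i \<phi>) \<longleftrightarrow> False"

text \<open>A formula with \<open>n\<close> free variables has its free variables among \<open>0, \<dots>, n - 1\<close>.\<close>

definition formula :: "'s signature \<Rightarrow> nat \<Rightarrow> 's fm \<Rightarrow> bool" where
  "formula \<sigma> n \<phi> \<longleftrightarrow> over \<sigma> \<phi> \<and> fv \<phi> \<subseteq> {..<n}"

text \<open>
  \<open>holds A \<phi> v\<close> assigns the \<open>i\<close>-th entry of \<open>v\<close> to variable \<open>i\<close>. It is only used for formulas with
  \<open>length v\<close> free variables, so the values of \<open>nth\<close> beyond the length are irrelevant.
\<close>

definition holds :: "('s, 'a) struct \<Rightarrow> 's fm \<Rightarrow> 'a list \<Rightarrow> bool" where
  "holds A \<phi> v \<longleftrightarrow> sat A (\<lambda>i. v ! i) \<phi>"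

section \<open>Interpretation schemes\<close>

text \<open>
  A sequence of \<open>r\<close> tuples of length \<open>p\<close> is substituted into a formula with \<open>p * r\<close> free variables
  by concatenation.
\<close>

record ('s, 'r) scheme =
  dim :: nat
  dom_fm :: "'s fm"
  rel_fm :: "'r \<Rightarrow> 's fm"

record ('s, 'r) gscheme = "('s, 'r) scheme" +
  eq_fm :: "'s fm"

definition is_scheme :: "'s signature \<Rightarrow> 'r signature \<Rightarrow> ('s, 'r, 'z) scheme_scheme \<Rightarrow> bool" where
  "is_scheme \<kappa> \<tau> I \<longleftrightarrow>
     formula \<kappa> (dim I) (dom_fm I) \<and>
     (\<forall>r\<in>syms \<tau>. formula \<kappa> (dim I * ar \<tau> r) (rel_fm I r))"

definition qf_scheme :: "'r signature \<Rightarrow> ('s, 'r, 'z) scheme_scheme \<Rightarrow> bool" where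
  "qf_scheme \<tau> I \<longleftrightarrow> qf (dom_fm I) \<and> (\<forall>r\<in>syms \<tau>. qf (rel_fm I r))"

definition dom_tuples :: "('s, 'r, 'z) scheme_scheme \<Rightarrow> ('s, 'a) struct \<Rightarrow> 'a list set" where
  "dom_tuples I A = {v \<in> tuples (univ A) (dim I). holds A (dom_fm I) v}"

definition interpret_scheme ::
    "'r signature \<Rightarrow> ('s, 'r) scheme \<Rightarrow> ('s, 'a) struct \<Rightarrow> ('r, 'a list) struct" where
  "interpret_scheme \<tau> I A =
     \<lparr>univ = dom_tuples I A,
      rel = (\<lambda>r. {vs \<in> tuples (dom_tuples I A) (ar \<tau> r). holds A (rel_fm I r) (concat vs)})\<rparr>"

definition eq_rel :: "('s, 'r) gscheme \<Rightarrow> ('s, 'a) struct \<Rightarrow> ('a list \<times> 'a list) set" where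
  "eq_rel I A = {(v, w). v \<in> tuples (univ A) (dim I) \<and> w \<in> tuples (univ A) (dim I) \<and>
                         holds A (eq_fm I) (v @ w)}"

abbreviation eq_class :: "('s, 'r) gscheme \<Rightarrow> ('s, 'a) struct \<Rightarrow> 'a list \<Rightarrow> 'a list set" where
  "eq_class I A v \<equiv> eq_rel I A `` {v}"

text \<open>
  The semantic conditions range over all finite structures of the signature \<open>\<kappa>\<close>. Quantifying over
  those whose domain is a set of natural numbers loses nothing, as every finite structure is
  isomorphic to one of them. Compatibility concerns the formulas of the relation symbols; the
  domain formula need not be invariant under the equivalence.
\<close>

definition is_gscheme :: "'s signature \<Rightarrow> 'r signature \<Rightarrow> ('s, 'r) gscheme \<Rightarrow> bool" where
  "is_gscheme \<kappa> \<tau> I \<longleftrightarrow>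
     is_scheme \<kappa> \<tau> I \<and>
     formula \<kappa> (2 * dim I) (eq_fm I) \<and>
     (\<forall>A :: ('s, nat) struct. is_struct \<kappa> A \<longrightarrow>
        equiv (tuples (univ A) (dim I)) (eq_rel I A) \<and>
        (\<forall>r\<in>syms \<tau>. \<forall>vs ws.
           length vs = ar \<tau> r \<longrightarrow> length ws = ar \<tau> r \<longrightarrow>
           (\<forall>j<ar \<tau> r. (vs ! j, ws ! j) \<in> eq_rel I A) \<longrightarrow>
           (holds A (rel_fm I r) (concat vs) \<longleftrightarrow> holds A (rel_fm I r) (concat ws))))"

definition qf_gscheme :: "'r signature \<Rightarrow> ('s, 'r) gscheme \<Rightarrow> bool" where
  "qf_gscheme \<tau> I \<longleftrightarrow> qf_scheme \<tau> I \<and> qf (eq_fm I)"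

definition interpret_gscheme ::
    "'r signature \<Rightarrow> ('s, 'r) gscheme \<Rightarrow> ('s, 'a) struct \<Rightarrow> ('r, 'a list set) struct" where
  "interpret_gscheme \<tau> I A =
     \<lparr>univ = eq_class I A ` dom_tuples I A,
      rel = (\<lambda>r. map (eq_class I A) `
                   {vs \<in> tuples (dom_tuples I A) (ar \<tau> r). holds A (rel_fm I r) (concat vs)})\<rparr>"

section \<open>Strong sums and the classes \<open>\<B> k \<ell>\<close>\<close>

text \<open>The strong sum of a family, with disjoint unions realised by tagging with the index.\<close>

definition sum_sig :: "'i set \<Rightarrow> ('i \<Rightarrow> 's signature) \<Rightarrow> ('i \<times> 's) signature" where
  "sum_sig J \<sigma> = \<lparr>syms = (SIGMA i:J. syms (\<sigma> i)), ar = (\<lambda>(i, s). ar (\<sigma> i) s)\<rparr>"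

definition strong_sum :: "'i set \<Rightarrow> ('i \<Rightarrow> ('s, 'a) struct) \<Rightarrow> ('i \<times> 's, 'i \<times> 'a) struct" where
  "strong_sum J A =
     \<lparr>univ = (SIGMA i:J. univ (A i)), rel = (\<lambda>(i, s). map (Pair i) ` rel (A i) s)\<rparr>"

datatype sym = U | S

definition E_sig :: "sym signature" where
  "E_sig = \<lparr>syms = {U}, ar = (\<lambda>_. 1)\<rparr>"

definition T_sig :: "sym signature" where
  "T_sig = \<lparr>syms = {U, S}, ar = (\<lambda>s. case s of U \<Rightarrow> 1 | S \<Rightarrow> 2)\<rparr>"

definition E_struct :: "(sym, nat) struct" where
  "E_struct = \<lparr>univ = {1}, rel = (\<lambda>s. case s of U \<Rightarrow> {[1]} | S \<Rightarrow> {})\<rparr>"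

definition T_struct :: "nat \<Rightarrow> (sym, nat) struct" where
  "T_struct M =
     \<lparr>univ = {1..M},
      rel = (\<lambda>s. case s of
                    U \<Rightarrow> {[i] | i. i \<in> {1..M}}
                  | S \<Rightarrow> {[i, j] | i j. i \<in> {1..M} \<and> j \<in> {1..M} \<and> i < j})\<rparr>"

text \<open>
  The symbols \<open>U\<^sup>E\<^sub>i\<close>, \<open>U\<^sup>T\<^sub>i\<close>, \<open>S\<^sub>i\<close> are \<open>(SE i, U)\<close>, \<open>(ST i, U)\<close>, \<open>(ST i, S)\<close>, with
  indices starting at \<open>0\<close>.
\<close>

datatype summand = SE nat | ST nat

definition summands :: "nat \<Rightarrow> nat \<Rightarrow> summand set" where
  "summands k l = SE ` {..<l} \<union> ST ` {..<k}"

definition beta :: "nat \<Rightarrow> nat \<Rightarrow> (summand \<times> sym) signature" where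
  "beta k l = sum_sig (summands k l) (\<lambda>x. case x of SE i \<Rightarrow> E_sig | ST i \<Rightarrow> T_sig)"

definition B_struct :: "nat \<Rightarrow> nat \<Rightarrow> (nat \<Rightarrow> nat) \<Rightarrow> (summand \<times> sym, summand \<times> nat) struct" where
  "B_struct k l N =
     strong_sum (summands k l) (\<lambda>x. case x of SE i \<Rightarrow> E_struct | ST i \<Rightarrow> T_struct (N i))"

definition B_class :: "nat \<Rightarrow> nat \<Rightarrow> (summand \<times> sym, summand \<times> nat) struct set" where
  "B_class k l = range (B_struct k l)"

lemma is_signature_beta: "is_signature (beta k l)"
  by (auto simp: is_signature_def beta_def sum_sig_def summands_def E_sig_def T_sig_def
      intro!: finite_SigmaI split: summand.splits)

lemma is_struct_B_class: "B \<in> B_class k l \<Longrightarrow> is_struct (beta k l) B"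
  by (auto simp: is_struct_def B_class_def B_struct_def beta_def sum_sig_def strong_sum_def
      summands_def E_sig_def T_sig_def E_struct_def T_struct_def tuples_def
      intro!: finite_SigmaI split: summand.splits)

end

theory Submission
  imports Defs
begin

text \<open>
  If \<open>v\<close> and \<open>w\<close> are equivalent, then every tournament element of \<open>w\<close> already occurs in \<open>v\<close>:
  otherwise, after stretching the tournaments, that element could be moved within a large gap
  without changing the quantifier-free type of \<open>(v, w)\<close>, so the class of \<open>v\<close> would be too large.
  Hence, up to the definable elements of the copies of \<open>\<^bold>E\<close>, an equivalence class lives on the
  entries of any one of its members. The lexicographically least element of a class
  (among those satisfying the domain formula) is thus determined by quantifier-free types, and
  \<open>\<rho>\<close> can be taken to say that a tuple is the least in its class.
\<close>

section \<open>Partial isomorphisms and quantifier-free formulas\<close>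

definition partial_iso ::
    "'s signature \<Rightarrow> ('a \<Rightarrow> 'b) \<Rightarrow> 'a set \<Rightarrow> ('s, 'a) struct \<Rightarrow> ('s, 'b) struct \<Rightarrow> bool" where
  "partial_iso \<sigma> g D A B \<longleftrightarrow>
     D \<subseteq> univ A \<and> g ` D \<subseteq> univ B \<and> inj_on g D \<and>
     (\<forall>s\<in>syms \<sigma>. \<forall>t\<in>tuples D (ar \<sigma> s). t \<in> rel A s \<longleftrightarrow> map g t \<in> rel B s)"

text \<open>Without quantifiers, evaluation never leaves the values of the free variables.
  Injectivity settles the equality atoms and the relation clause of \<open>partial_iso\<close> the
  others. The condition is confined to \<open>fv\<close>, so that list lookup beyond the length does
  no harm.\<close>

lemma sat_partial_iso:
  assumes "partial_iso \<sigma> g D A B"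
  shows "\<lbrakk>qf \<phi>; over \<sigma> \<phi>; \<forall>i\<in>fv \<phi>. e i \<in> D \<and> e' i = g (e i)\<rbrakk> \<Longrightarrow> sat B e' \<phi> \<longleftrightarrow> sat A e \<phi>"
proof (induction \<phi>)
  case (Eq i j)
  then show ?case using assms by (auto simp: partial_iso_def inj_on_eq_iff)
next
  case (Rel s ix)
  have "map e ix \<in> tuples D (ar \<sigma> s)" "map e' ix = map g (map e ix)"
    using Rel by (auto simp: tuples_def)
  then show ?case using assms Rel by (auto simp only: partial_iso_def sat.simps over.simps)
qed auto

lemma holds_partial_iso:
  assumes "partial_iso \<sigma> g D A B" "qf \<phi>" "formula \<sigma> n \<phi>" "v \<in> tuples D n"
  shows "holds B \<phi> (map g v) \<longleftrightarrow> holds A \<phi> v"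
  unfolding holds_def
proof (rule sat_partial_iso[OF assms(1,2)])
  show "\<forall>i\<in>fv \<phi>. v ! i \<in> D \<and> map g v ! i = g (v ! i)"
    using assms(3,4) by (force simp: formula_def tuples_def)
qed (use assms(3) in \<open>simp add: formula_def\<close>)

lemma map_tuples: "g ` D \<subseteq> E \<Longrightarrow> v \<in> tuples D n \<Longrightarrow> map g v \<in> tuples E n"
  by (auto simp: tuples_def)

lemma tuples_mono: "D \<subseteq> E \<Longrightarrow> v \<in> tuples D n \<Longrightarrow> v \<in> tuples E n"
  by (auto simp: tuples_def)

lemma append_tuples: "v \<in> tuples D m \<Longrightarrow> w \<in> tuples D n \<Longrightarrow> v @ w \<in> tuples D (m + n)"
  by (auto simp: tuples_def)

lemma concat_tuples:
  "vs \<in> tuples (tuples D p) n \<Longrightarrow> concat vs \<in> tuples D (p * n)"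
proof (induction vs arbitrary: n)
  case (Cons v vs)
  then obtain m where n: "n = Suc m" by (cases n) (auto simp: tuples_def)
  with Cons have "concat vs \<in> tuples D (p * m)" "v \<in> tuples D p" by (auto simp: tuples_def)
  then show ?case using append_tuples[of v D p "concat vs" "p * m"] n by simp
qed (auto simp: tuples_def)

lemma finite_tuples: "finite A \<Longrightarrow> finite (tuples A n)"
  using finite_lists_length_eq[of A n] by (simp add: tuples_def conj_commute)

section \<open>Interpretation schemes under partial isomorphisms\<close>

lemma dom_tuples_partial_iso:
  assumes "partial_iso \<kappa> g D A B" "is_scheme \<kappa> \<tau> I" "qf_scheme \<tau> I" "v \<in> tuples D (dim I)"
  shows "map g v \<in> dom_tuples I B \<longleftrightarrow> v \<in> dom_tuples I A"
proof -
  have "holds B (dom_fm I) (map g v) \<longleftrightarrow> holds A (dom_fm I) v"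
    using assms by (intro holds_partial_iso) (auto simp: is_scheme_def qf_scheme_def)
  moreover have "v \<in> tuples (univ A) (dim I)" "map g v \<in> tuples (univ B) (dim I)"
    using assms(1,4) tuples_mono map_tuples by (auto simp: partial_iso_def)
  ultimately show ?thesis by (simp add: dom_tuples_def)
qed

lemma eq_rel_partial_iso:
  assumes "partial_iso \<kappa> g D A B" "is_gscheme \<kappa> \<tau> I" "qf_gscheme \<tau> I"
    and v: "v \<in> tuples D (dim I)" and w: "w \<in> tuples D (dim I)"
  shows "(map g v, map g w) \<in> eq_rel I B \<longleftrightarrow> (v, w) \<in> eq_rel I A"
proof -
  have "holds B (eq_fm I) (map g (v @ w)) \<longleftrightarrow> holds A (eq_fm I) (v @ w)"
    using assms append_tuples[OF v w]
    by (intro holds_partial_iso[where n = "2 * dim I"])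
       (auto simp: is_gscheme_def qf_gscheme_def mult_2)
  moreover have "x \<in> tuples (univ A) (dim I) \<and> map g x \<in> tuples (univ B) (dim I)"
    if "x \<in> tuples D (dim I)" for x
    using assms(1) that tuples_mono map_tuples by (auto simp: partial_iso_def)
  ultimately show ?thesis using v w by (simp add: eq_rel_def)
qed

text \<open>The conditions in \<open>is_gscheme\<close> speak of structures on natural numbers only,
  while the structures in \<open>B_class\<close> live on \<open>summand \<times> nat\<close>. A copy
  of \<open>B\<close> on natural numbers satisfies the conditions, and the isomorphism onto it
  carries them back, all formulas being quantifier-free.\<close>

lemma is_gscheme_struct:
  fixes B :: "('s, 'a) struct"
  assumes I: "is_gscheme \<kappa> \<tau> I" "qf_gscheme \<tau> I" and B: "is_struct \<kappa> B"
  shows "equiv (tuples (univ B) (dim I)) (eq_rel I B)"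
    and "\<lbrakk>r \<in> syms \<tau>; length vs = ar \<tau> r; length ws = ar \<tau> r;
          \<And>j. j < ar \<tau> r \<Longrightarrow> (vs ! j, ws ! j) \<in> eq_rel I B\<rbrakk>
         \<Longrightarrow> holds B (rel_fm I r) (concat vs) \<longleftrightarrow> holds B (rel_fm I r) (concat ws)"
proof -
  obtain h :: "'a \<Rightarrow> nat" where h: "inj_on h (univ B)"
    using B finite_imp_inj_to_nat_seg by (metis is_struct_def)
  define A where "A = \<lparr>univ = h ` univ B, rel = (\<lambda>s. map h ` rel B s)\<rparr>"
  have piso: "partial_iso \<kappa> h (univ B) B A"
  proof -
    \<comment> \<open>The relations of \<open>A\<close> are images under \<open>map h\<close>.
      Reflecting them requires \<open>map h\<close> to be injective on lists over the domain of
      \<open>B\<close>.\<close>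
    have "t \<in> rel B s" if "s \<in> syms \<kappa>" "set t \<subseteq> univ B" "map h t = map h u" "u \<in> rel B s" for s t u
    proof -
      have "set u \<subseteq> univ B" using B that by (auto simp: is_struct_def tuples_def)
      then have "inj_on h (set t \<union> set u)" using h that(2) by (auto intro: inj_on_subset)
      then show ?thesis using that map_inj_on by metis
    qed
    then show ?thesis using h by (auto simp: partial_iso_def A_def tuples_def)
  qed
  have "is_struct \<kappa> A"
    using B by (fastforce simp: is_struct_def A_def tuples_def)
  then have eqA: "equiv (tuples (univ A) (dim I)) (eq_rel I A)"
    and compat: "\<And>r vs ws. \<lbrakk>r \<in> syms \<tau>; length vs = ar \<tau> r; length ws = ar \<tau> r;
      \<forall>j < ar \<tau> r. (vs ! j, ws ! j) \<in> eq_rel I A\<rbrakk>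
      \<Longrightarrow> holds A (rel_fm I r) (concat vs) \<longleftrightarrow> holds A (rel_fm I r) (concat ws)"
    using I(1) unfolding is_gscheme_def by blast+
  note eq_iff = eq_rel_partial_iso[OF piso I]
  have sub: "eq_rel I B \<subseteq> tuples (univ B) (dim I) \<times> tuples (univ B) (dim I)"
    by (auto simp: eq_rel_def)
  have memA: "map h v \<in> tuples (univ A) (dim I)" if "v \<in> tuples (univ B) (dim I)" for v
    using that by (auto simp: A_def tuples_def)
  show "equiv (tuples (univ B) (dim I)) (eq_rel I B)"
  proof (rule equivI)
    show "refl_on (tuples (univ B) (dim I)) (eq_rel I B)"
      using eqA eq_iff memA unfolding equiv_def refl_on_def by blast
    show "sym (eq_rel I B)"
      using eqA eq_iff sub unfolding equiv_def sym_def by blast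
    show "trans (eq_rel I B)"
      using eqA eq_iff sub unfolding equiv_def trans_def by blast
  qed (rule sub)
  assume r: "r \<in> syms \<tau>" and len: "length vs = ar \<tau> r" "length ws = ar \<tau> r"
    and R: "\<And>j. j < ar \<tau> r \<Longrightarrow> (vs ! j, ws ! j) \<in> eq_rel I B"
  have "vs ! j \<in> tuples (univ B) (dim I)" "ws ! j \<in> tuples (univ B) (dim I)" if "j < ar \<tau> r" for j
    using R[OF that] sub by auto
  then have mem: "vs \<in> tuples (tuples (univ B) (dim I)) (ar \<tau> r)"
    "ws \<in> tuples (tuples (univ B) (dim I)) (ar \<tau> r)"
    using len unfolding tuples_def[of "tuples _ _"] by (auto simp: set_conv_nth)
  have holds_iff: "holds A (rel_fm I r) (concat (map (map h) us)) \<longleftrightarrow> holds B (rel_fm I r) (concat us)"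
    if "us \<in> tuples (tuples (univ B) (dim I)) (ar \<tau> r)" for us
    \<comment> \<open>The tuples are mapped one by one. Reading this as mapping their concatenation
      yields one list of length \<open>dim I * ar \<tau> r\<close>, to which transfer of formulas
      applies.\<close>
    unfolding map_concat[symmetric]
  proof (rule holds_partial_iso[OF piso _ _ concat_tuples[OF that]])
    show "qf (rel_fm I r)" using I(2) r by (simp add: qf_gscheme_def qf_scheme_def)
    show "formula \<kappa> (dim I * ar \<tau> r) (rel_fm I r)"
      using I(1) r by (simp add: is_gscheme_def is_scheme_def)
  qed
  have "(map h (vs ! j), map h (ws ! j)) \<in> eq_rel I A" if "j < ar \<tau> r" for j
    using R[OF that] sub eq_iff by blast
  then have "holds A (rel_fm I r) (concat (map (map h) vs))
      \<longleftrightarrow> holds A (rel_fm I r) (concat (map (map h) ws))"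
    using len r by (intro compat) auto
  then show "holds B (rel_fm I r) (concat vs) \<longleftrightarrow> holds B (rel_fm I r) (concat ws)"
    using holds_iff mem by simp
qed

section \<open>Definability of type-invariant properties\<close>

definition atoms :: "'s signature \<Rightarrow> nat \<Rightarrow> 's fm set" where
  "atoms \<sigma> n = (\<lambda>(i, j). Eq i j) ` ({..<n} \<times> {..<n}) \<union>
     (\<Union>s\<in>syms \<sigma>. Rel s ` tuples {..<n} (ar \<sigma> s))"

text \<open>Negative information is carried by absence: an atom outside the set is false. The set
  therefore determines the truth of every quantifier-free formula over \<sigma> in
  \<open>length v\<close> variables.\<close>

definition qf_type :: "'s signature \<Rightarrow> ('s, 'a) struct \<Rightarrow> 'a list \<Rightarrow> 's fm set" where
  "qf_type \<sigma> A v = {\<phi> \<in> atoms \<sigma> (length v). holds A \<phi> v}"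

lemma finite_atoms: "is_signature \<sigma> \<Longrightarrow> finite (atoms \<sigma> n)"
  by (auto simp: atoms_def is_signature_def intro!: finite_tuples)

text \<open>Induction on \<open>F\<close> by case distinction on the new formula \<open>a\<close>:
  if \<open>a\<close> is true, a formula for the predicate \<open>P (insert a T)\<close> decides,
  otherwise one for \<open>P T\<close>. Hence \<open>P\<close> must be arbitrary in the induction.
  The formula obtained depends on neither structure nor tuple.\<close>

lemma qf_definable:
  assumes "finite F" "\<forall>\<phi>\<in>F. qf \<phi> \<and> formula \<sigma> n \<phi>"
  shows "\<exists>\<phi>. qf \<phi> \<and> formula \<sigma> n \<phi> \<and>
     (\<forall>(A :: ('s, 'a) struct) v. holds A \<phi> v \<longleftrightarrow> P {\<psi> \<in> F. holds A \<psi> v})"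
  using assms
proof (induction F arbitrary: P rule: finite_induct)
  case empty
  show ?case
    by (rule exI[of _ "if P {} then Neg Bot else Bot"]) (auto simp: formula_def holds_def)
next
  case (insert a F)
  obtain \<phi> where \<phi>: "qf \<phi>" "formula \<sigma> n \<phi>"
    "\<And>(A :: ('s, 'a) struct) v. holds A \<phi> v \<longleftrightarrow> P (insert a {\<psi> \<in> F. holds A \<psi> v})"
    using insert.IH[of "\<lambda>T. P (insert a T)"] insert.prems by auto
  obtain \<chi> where \<chi>: "qf \<chi>" "formula \<sigma> n \<chi>"
    "\<And>(A :: ('s, 'a) struct) v. holds A \<chi> v \<longleftrightarrow> P {\<psi> \<in> F. holds A \<psi> v}"
    using insert.IH[of P] insert.prems by auto
  let ?\<theta> = "Disj (Conj a \<phi>) (Conj (Neg a) \<chi>)"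
  have "holds A ?\<theta> v \<longleftrightarrow> P {\<psi> \<in> insert a F. holds A \<psi> v}" for A :: "('s, 'a) struct" and v
  proof -
    have "{\<psi> \<in> insert a F. holds A \<psi> v} =
      (if holds A a v then insert a {\<psi> \<in> F. holds A \<psi> v} else {\<psi> \<in> F. holds A \<psi> v})"
      by auto
    moreover have "holds A ?\<theta> v \<longleftrightarrow> (if holds A a v then holds A \<phi> v else holds A \<chi> v)"
      by (simp add: holds_def)
    ultimately show ?thesis using \<phi>(3) \<chi>(3) by simp
  qed
  moreover have "qf ?\<theta>" "formula \<sigma> n ?\<theta>"
    using \<phi> \<chi> insert.prems by (auto simp: formula_def)
  ultimately show ?case by blast
qed

lemma qf_type_invariant_definable:
  fixes K :: "('s, 'a) struct set"
  assumes "is_signature \<sigma>"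
    and inv: "\<And>A v B w. \<lbrakk>A \<in> K; B \<in> K; v \<in> tuples (univ A) n; w \<in> tuples (univ B) n;
                qf_type \<sigma> A v = qf_type \<sigma> B w; Q A v\<rbrakk> \<Longrightarrow> Q B w"
  obtains \<phi> where "qf \<phi>" "formula \<sigma> n \<phi>"
    "\<And>A v. A \<in> K \<Longrightarrow> v \<in> tuples (univ A) n \<Longrightarrow> holds A \<phi> v \<longleftrightarrow> Q A v"
proof -
  \<comment> \<open>A type is accepted if some realisation of it in \<open>K\<close> satisfies
    \<open>Q\<close>. By invariance, all its realisations in \<open>K\<close> then satisfy
    \<open>Q\<close>.\<close>
  define P where "P T \<longleftrightarrow> (\<exists>A\<in>K. \<exists>v\<in>tuples (univ A) n. qf_type \<sigma> A v = T \<and> Q A v)" for T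
  have "\<forall>\<phi>\<in>atoms \<sigma> n. qf \<phi> \<and> formula \<sigma> n \<phi>"
    by (auto simp: atoms_def formula_def tuples_def)
  from qf_definable[OF finite_atoms[OF assms(1)] this, of P] obtain \<phi> where
    \<phi>: "qf \<phi>" "formula \<sigma> n \<phi>"
    "\<And>(A :: ('s, 'a) struct) v. holds A \<phi> v \<longleftrightarrow> P {\<psi> \<in> atoms \<sigma> n. holds A \<psi> v}"
    by blast
  have "holds A \<phi> v \<longleftrightarrow> Q A v" if A: "A \<in> K" "v \<in> tuples (univ A) n" for A v
  proof -
    have "holds A \<phi> v \<longleftrightarrow> P (qf_type \<sigma> A v)"
      using \<phi>(3) that by (simp add: qf_type_def tuples_def)
    also have "\<dots> \<longleftrightarrow> Q A v"
      using inv A unfolding P_def by blast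
    finally show ?thesis .
  qed
  with \<phi>(1,2) show thesis by (rule that)
qed

section \<open>The structures of \<open>\<B> k \<ell>\<close>\<close>

lemma univ_B_struct:
  "x \<in> univ (B_struct k l N) \<longleftrightarrow>
     (\<exists>i<l. x = (SE i, 1)) \<or> (\<exists>j<k. \<exists>a\<in>{1..N j}. x = (ST j, a))"
  by (cases x; cases "fst x")
     (auto simp: B_struct_def strong_sum_def summands_def E_struct_def T_struct_def)

lemma rel_B_struct:
  "t \<in> rel (B_struct k l N) (SE i, U) \<longleftrightarrow> t = [(SE i, 1)]"
  "t \<in> rel (B_struct k l N) (ST j, U) \<longleftrightarrow> (\<exists>a\<in>{1..N j}. t = [(ST j, a)])"
  "t \<in> rel (B_struct k l N) (ST j, S) \<longleftrightarrow>
     (\<exists>a\<in>{1..N j}. \<exists>b\<in>{1..N j}. a < b \<and> t = [(ST j, a), (ST j, b)])"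
proof -
  have U: "t \<in> map (Pair x) ` {[a] | a. a \<in> X} \<longleftrightarrow> (\<exists>a\<in>X. t = [(x, a)])" for X and x :: summand
    by (auto intro!: image_eqI[of _ _ "[_]"])
  have S: "t \<in> map (Pair x) ` {[a, b] | a b. a \<in> X \<and> b \<in> X \<and> a < b} \<longleftrightarrow>
      (\<exists>a\<in>X. \<exists>b\<in>X. a < b \<and> t = [(x, a), (x, b)])" for X and x :: summand
    by (auto intro!: image_eqI[of _ _ "[_, _]"])
  show "t \<in> rel (B_struct k l N) (SE i, U) \<longleftrightarrow> t = [(SE i, 1)]"
    by (auto simp: B_struct_def strong_sum_def E_struct_def)
  show "t \<in> rel (B_struct k l N) (ST j, U) \<longleftrightarrow> (\<exists>a\<in>{1..N j}. t = [(ST j, a)])"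
    using U[of "ST j" "{1..N j}"] by (simp add: B_struct_def strong_sum_def T_struct_def)
  show "t \<in> rel (B_struct k l N) (ST j, S) \<longleftrightarrow>
     (\<exists>a\<in>{1..N j}. \<exists>b\<in>{1..N j}. a < b \<and> t = [(ST j, a), (ST j, b)])"
    using S[of "ST j" "{1..N j}"] by (simp add: B_struct_def strong_sum_def T_struct_def)
qed

lemma beta_simps:
  "(SE i, U) \<in> syms (beta k l) \<longleftrightarrow> i < l" "(SE i, S) \<notin> syms (beta k l)"
  "(ST j, s) \<in> syms (beta k l) \<longleftrightarrow> j < k"
  "ar (beta k l) (x, U) = 1" "ar (beta k l) (ST j, S) = 2"
  by (cases x; cases s; auto simp: beta_def sum_sig_def summands_def E_sig_def T_sig_def)+

text \<open>Each summand is a point or a linear order, and the unary relations only name the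
  summands. Keeping the summand and increasing strictly inside it therefore preserves and reflects
  all relations. The tournament lengths on the two sides may differ.\<close>

lemma partial_iso_B_struct:
  assumes D: "D \<subseteq> univ (B_struct k l N)" and g: "g ` D \<subseteq> univ (B_struct k l M)"
    and fst: "\<And>x. x \<in> D \<Longrightarrow> fst (g x) = fst x"
    and mono: "\<And>x y. \<lbrakk>x \<in> D; y \<in> D; fst x = fst y; snd x < snd y\<rbrakk> \<Longrightarrow> snd (g x) < snd (g y)"
  shows "partial_iso (beta k l) g D (B_struct k l N) (B_struct k l M)"
proof -
  \<comment> \<open>Positions in a summand are linearly ordered, so strict monotonicity in one
    direction also reflects the order.\<close>
  have mono_iff: "snd (g x) < snd (g y) \<longleftrightarrow> snd x < snd y"
    if "x \<in> D" "y \<in> D" "fst x = fst y" for x y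
    using mono[of x y] mono[of y x] that
    by (cases "snd x" "snd y" rule: linorder_cases) (auto dest: prod_eqI)
  have "inj_on g D"
  proof (rule inj_onI)
    fix x y assume xy: "x \<in> D" "y \<in> D" "g x = g y"
    then have "fst x = fst y" using fst by metis
    moreover have "\<not> snd x < snd y" "\<not> snd y < snd x"
      using mono xy calculation by (metis order_less_irrefl)+
    ultimately show "x = y" by (simp add: prod_eq_iff)
  qed
  moreover have "t \<in> rel (B_struct k l N) s \<longleftrightarrow> map g t \<in> rel (B_struct k l M) s"
    if s: "s \<in> syms (beta k l)" and t: "t \<in> tuples D (ar (beta k l) s)" for s t
  proof -
    \<comment> \<open>Inside the two domains, membership in a unary relation depends on the first
      component alone, which \<open>g\<close> keeps.\<close>
    have E: "g x = (SE i, 1) \<longleftrightarrow> x = (SE i, 1)" if "x \<in> D" for x i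
    proof -
      have "x \<in> univ (B_struct k l N)" "g x \<in> univ (B_struct k l M)" using D g that by auto
      then show ?thesis using fst[OF that] by (auto simp: univ_B_struct)
    qed
    have T: "(\<exists>a\<in>{1..M j}. g x = (ST j, a)) \<longleftrightarrow> (\<exists>a\<in>{1..N j}. x = (ST j, a))" if "x \<in> D" for x j
    proof -
      have "x \<in> univ (B_struct k l N)" "g x \<in> univ (B_struct k l M)" using D g that by auto
      then show ?thesis using fst[OF that] by (auto simp: univ_B_struct)
    qed
    consider i where "s = (SE i, U)" | j where "s = (ST j, U)" | j where "s = (ST j, S)"
      using s by (cases s; cases "fst s"; cases "snd s") (auto simp: beta_simps)
    then show ?thesis
    proof cases
      case 1
      then obtain x where "t = [x]" "x \<in> D"
        using t by (auto simp: beta_simps tuples_def length_Suc_conv)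
      then show ?thesis using 1 E by (simp add: rel_B_struct)
    next
      case (2 j)
      then obtain x where "t = [x]" "x \<in> D"
        using t by (auto simp: beta_simps tuples_def length_Suc_conv)
      then show ?thesis using 2 T[of x j] by (simp add: rel_B_struct)
    next
      case (3 j)
      then obtain x y where xy: "t = [x, y]" "x \<in> D" "y \<in> D"
        using t by (auto simp: beta_simps tuples_def length_Suc_conv numeral_2_eq_2)
      have S: "[x, y] \<in> rel (B_struct k l L) (ST j, S) \<longleftrightarrow>
          (\<exists>a\<in>{1..L j}. x = (ST j, a)) \<and> (\<exists>a\<in>{1..L j}. y = (ST j, a)) \<and> snd x < snd y" for L x y
        by (auto simp: rel_B_struct)
      have "fst x = fst y" if "\<exists>a\<in>{1..N j}. x = (ST j, a)" "\<exists>a\<in>{1..N j}. y = (ST j, a)"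
        using that by auto
      then show ?thesis unfolding 3 xy(1) list.map S using T[of x j] T[of y j] xy mono_iff by blast
    qed
  qed
  ultimately show ?thesis using D g by (simp add: partial_iso_def)
qed

section \<open>Bounded classes, and maps obtained from equal types\<close>

text \<open>Stretching all tournaments by the factor \<open>M\<close> gives \<open>M\<close>
  embeddings \<open>f c\<close>, which differ only in the image of \<open>(ST j, a)\<close>. If this
  element is missing from \<open>v\<close>, they all agree on \<open>v\<close> but yield
  \<open>M\<close> different images of \<open>w\<close>, all in the class of the image of
  \<open>v\<close>.\<close>

lemma tournament_entries_of_equivalent:
  assumes I: "is_gscheme (beta k l) \<tau> I" "qf_gscheme \<tau> I"
    and bound: "\<And>B v. B \<in> B_class k l \<Longrightarrow> v \<in> tuples (univ B) (dim I) \<Longrightarrow> card (eq_class I B v) \<le> C"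
    and vw: "(v, w) \<in> eq_rel I (B_struct k l N)"
    and a: "(ST j, a) \<in> set w"
  shows "(ST j, a) \<in> set v"
proof (rule ccontr)
  assume nv: "(ST j, a) \<notin> set v"
  let ?B = "B_struct k l N"
  \<comment> \<open>One more than the bound on the classes, so that \<open>M\<close> members of one
    class are a contradiction.\<close>
  define M where "M = C + 1"
  let ?B' = "B_struct k l (\<lambda>i. M * N i)"
  \<comment> \<open>Position \<open>n\<close> of a tournament becomes a block of \<open>M\<close>
    positions ending at \<open>M * n\<close>. Elements go to the top of their block; only
    \<open>(ST j, a)\<close> is lowered by \<open>c\<close>, which for \<open>c < M\<close> stays
    inside the block.\<close>
  define f where "f c x = (case fst x of SE i \<Rightarrow> x
    | ST i \<Rightarrow> (ST i, M * snd x - (if x = (ST j, a) then c else 0)))" for c and x :: "summand \<times> nat"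
  have v: "v \<in> tuples (univ ?B) (dim I)" and w: "w \<in> tuples (univ ?B) (dim I)"
    using vw by (auto simp: eq_rel_def)
  have gap: "M * m + M \<le> M * n" if "m < n" for m n
    using mult_le_mono2[of "Suc m" n M] that by (simp add: add.commute)
  have piso: "partial_iso (beta k l) (f c) (univ ?B) ?B ?B'" if c: "c < M" for c
  proof (rule partial_iso_B_struct)
    have "f c x \<in> univ ?B'" if x: "x \<in> univ ?B" for x
    proof (cases "fst x")
      case (SE i)
      then show ?thesis using x by (auto simp: f_def univ_B_struct)
    next
      case (ST i)
      then have i: "i < k" "snd x \<in> {1..N i}" using x by (auto simp: univ_B_struct)
      then have "M \<le> M * snd x" "M * snd x \<le> M * N i" by auto
      moreover have "(if x = (ST j, a) then c else 0) < M" using c by simp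
      ultimately have "M * snd x - (if x = (ST j, a) then c else 0) \<in> {1..M * N i}"
        unfolding atLeastAtMost_iff by linarith
      then show ?thesis using i ST unfolding f_def univ_B_struct by simp
    qed
    then show "f c ` univ ?B \<subseteq> univ ?B'" by blast
    show "fst (f c x) = fst x" for x by (simp add: f_def split: summand.split)
    show "snd (f c x) < snd (f c y)"
      if "x \<in> univ ?B" "y \<in> univ ?B" "fst x = fst y" "snd x < snd y" for x y
    proof (cases "fst x")
      case (SE i)
      then show ?thesis using that by (auto simp: univ_B_struct)
    next
      case (ST i)
      \<comment> \<open>Lowering the larger element \<open>y\<close> by less than \<open>M\<close>
        leaves it above the block of \<open>x\<close>; lowering \<open>x\<close> can only
        help.\<close>
      have "M * snd x < M * snd y - (if y = (ST j, a) then c else 0)"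
      proof -
        have "(if y = (ST j, a) then c else 0) < M" using c by simp
        then show ?thesis using gap[OF that(4)] by linarith
      qed
      then show ?thesis using ST that(3) by (simp add: f_def less_imp_diff_less)
    qed
  qed simp
  have fv: "map (f c) v = map (f 0) v" for c
    using nv by (auto simp: f_def split: summand.split)
  have "(map (f 0) v, map (f c) w) \<in> eq_rel I ?B'" if "c < M" for c
    using eq_rel_partial_iso[OF piso[OF that] I v w] vw fv[of c] by simp
  then have sub: "(\<lambda>c. map (f c) w) ` {..<M} \<subseteq> eq_class I ?B' (map (f 0) v)" by auto
  \<comment> \<open>Positions start at 1, hence \<open>M * a\<close> is at least \<open>M\<close>.
    The truncated subtraction \<open>M * a - c\<close> is then injective in
    \<open>c < M\<close>.\<close>
  have "a \<ge> 1" using a w by (auto simp: tuples_def univ_B_struct)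
  then have "M \<le> M * a" using gap[of 0 a] by simp
  have "inj_on (\<lambda>c. map (f c) w) {..<M}"
  proof (rule inj_onI)
    fix c d assume cd: "c \<in> {..<M}" "d \<in> {..<M}" "map (f c) w = map (f d) w"
    then have "f c (ST j, a) = f d (ST j, a)" using a by (metis map_eq_conv)
    then have "M * a - c = M * a - d" by (simp add: f_def)
    then show "c = d" using cd(1,2) \<open>M \<le> M * a\<close> unfolding lessThan_iff by linarith
  qed
  then have "card ((\<lambda>c. map (f c) w) ` {..<M}) = M" by (simp add: card_image)
  moreover have B': "?B' \<in> B_class k l" by (simp add: B_class_def)
  \<comment> \<open>Finiteness makes the comparison of cardinalities valid, as \<open>card\<close>
    is 0 on infinite sets.\<close>
  have "finite (eq_class I ?B' (map (f 0) v))"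
    by (rule finite_subset[of _ "tuples (univ ?B') (dim I)"])
       (use is_struct_B_class[OF B'] in \<open>auto simp: eq_rel_def is_struct_def intro: finite_tuples\<close>)
  ultimately have "M \<le> card (eq_class I ?B' (map (f 0) v))"
    using card_mono[OF _ sub] by simp
  moreover have "map (f 0) v \<in> tuples (univ ?B') (dim I)"
    using piso[of 0] v by (auto simp: partial_iso_def M_def intro: map_tuples)
  ultimately show False using bound[OF B'] M_def by fastforce
qed

text \<open>The copies of \<open>\<^bold>E\<close> can be added to the domain because their elements are definable.\<close>

lemma qf_type_eq_partial_iso:
  assumes v: "v \<in> tuples (univ (B_struct k l N)) n" and w: "w \<in> tuples (univ (B_struct k l M)) n"
    and tp: "qf_type (beta k l) (B_struct k l N) v = qf_type (beta k l) (B_struct k l M) w"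
  obtains g where
    "partial_iso (beta k l) g (set v \<union> {(SE i, 1) | i. i < l}) (B_struct k l N) (B_struct k l M)"
    "map g v = w"
    "\<And>x. x \<in> set v \<union> {(SE i, 1) | i. i < l} \<Longrightarrow> fst (g x) = fst x"
    "\<And>x y. \<lbrakk>x \<in> set v \<union> {(SE i, 1) | i. i < l}; y \<in> set v \<union> {(SE i, 1) | i. i < l};
       fst x = fst y; snd x < snd y\<rbrakk> \<Longrightarrow> snd (g x) < snd (g y)"
proof -
  let ?A = "B_struct k l N" and ?B = "B_struct k l M"
  let ?D = "set v \<union> {(SE i, 1) | i. i < l}"
  have len: "length v = n" "length w = n" using v w by (auto simp: tuples_def)
  have mem: "v ! i \<in> univ ?A" "w ! i \<in> univ ?B" if "i < n" for i
    using v w that by (auto simp: tuples_def)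
  have tp_iff: "holds ?A \<phi> v \<longleftrightarrow> holds ?B \<phi> w" if "\<phi> \<in> atoms (beta k l) n" for \<phi>
  proof -
    have "\<phi> \<in> qf_type (beta k l) ?A v \<longleftrightarrow> \<phi> \<in> qf_type (beta k l) ?B w" by (simp add: tp)
    then show ?thesis using that len by (simp add: qf_type_def)
  qed
  have eq: "v ! i = v ! j \<longleftrightarrow> w ! i = w ! j" if "i < n" "j < n" for i j
    using tp_iff[of "Eq i j"] that by (auto simp: atoms_def holds_def)
  have rel: "map ((!) v) ix \<in> rel ?A s \<longleftrightarrow> map ((!) w) ix \<in> rel ?B s"
    if "s \<in> syms (beta k l)" "ix \<in> tuples {..<n} (ar (beta k l) s)" for s ix
    using tp_iff[of "Rel s ix"] that by (auto simp: atoms_def holds_def)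
  \<comment> \<open>The relation of a copy of the point structure holds of a single element, so
    equal types place it at the same indices of \<open>v\<close> and \<open>w\<close>.\<close>
  have E: "v ! i = (SE m, 1) \<longleftrightarrow> w ! i = (SE m, 1)" if "i < n" "m < l" for i m
    using rel[of "(SE m, U)" "[i]"] that by (simp add: beta_simps tuples_def rel_B_struct)
  have fst_vw: "fst (w ! i) = fst (v ! i)" if "i < n" for i
    using mem(1)[OF that] unfolding univ_B_struct
  proof (elim disjE exE conjE bexE, goal_cases)
    case (1 m)
    then show ?thesis using E[OF that, of m] by simp
  next
    case (2 m a)
    then show ?thesis
      using rel[of "(ST m, U)" "[i]"] that by (auto simp: beta_simps tuples_def rel_B_struct)
  qed
  have less: "snd (w ! i) < snd (w ! j)"
    if ij: "i < n" "j < n" "fst (v ! i) = fst (v ! j)" "snd (v ! i) < snd (v ! j)" for i j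
  proof -
    \<comment> \<open>Two different positions in one summand exist only in a tournament.\<close>
    obtain m a b where m: "m < k" "a \<in> {1..N m}" "b \<in> {1..N m}" "v ! i = (ST m, a)" "v ! j = (ST m, b)"
      using mem(1)[OF ij(1)] mem(1)[OF ij(2)] ij(3,4) by (auto simp: univ_B_struct)
    have "[w ! i, w ! j] \<in> rel ?B (ST m, S)"
      using rel[of "(ST m, S)" "[i, j]"] ij m by (simp add: beta_simps tuples_def rel_B_struct)
    then show ?thesis by (auto simp: rel_B_struct)
  qed
  \<comment> \<open>Elements of the point copies are fixed; an entry of \<open>v\<close> goes to the
    entry of \<open>w\<close> at the same index. The chosen index does not matter by
    \<open>eq\<close>, and the two clauses agree by \<open>E\<close>.\<close>
  define g where "g x = (if \<exists>i<l. x = (SE i, 1) then x else w ! (SOME i. i < n \<and> v ! i = x))" for x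
  have g_nth: "g (v ! i) = w ! i" if "i < n" for i
  proof (cases "\<exists>m<l. v ! i = (SE m, 1)")
    case True
    then show ?thesis using E that by (auto simp: g_def)
  next
    case False
    have "(SOME i'. i' < n \<and> v ! i' = v ! i) < n \<and> v ! (SOME i'. i' < n \<and> v ! i' = v ! i) = v ! i"
      by (rule someI[of _ i]) (use that in simp)
    then show ?thesis using False eq[OF _ that] by (auto simp: g_def)
  qed
  have D_cases: "(\<exists>i<n. x = v ! i) \<or> (\<exists>i<l. x = (SE i, 1))" if "x \<in> ?D" for x
    using that len by (auto simp: in_set_conv_nth)
  have g_E: "g (SE i, 1) = (SE i, 1)" if "i < l" for i using that by (simp add: g_def)
  have fst: "fst (g x) = fst x" if "x \<in> ?D" for x
    using D_cases[OF that] g_nth fst_vw g_E by auto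
  have sub: "?D \<subseteq> univ ?A" using v by (auto simp: tuples_def univ_B_struct)
  have mono: "snd (g x) < snd (g y)"
    if xy: "x \<in> ?D" "y \<in> ?D" "fst x = fst y" "snd x < snd y" for x y
  proof -
    \<comment> \<open>Strict inequality within a summand rules out the point copies, so both
      elements are entries of \<open>v\<close>.\<close>
    have "fst x \<noteq> SE i" for i
      using subsetD[OF sub xy(1)] subsetD[OF sub xy(2)] xy(3,4) by (auto simp: univ_B_struct)
    then obtain i j where "i < n" "j < n" "x = v ! i" "y = v ! j"
      using D_cases[OF xy(1)] D_cases[OF xy(2)] xy(3) by (metis fst_conv)
    then show ?thesis using less g_nth xy by simp
  qed
  have "g ` ?D \<subseteq> univ ?B"
  proof
    fix y assume "y \<in> g ` ?D"
    then obtain x where "x \<in> ?D" "y = g x" by blast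
    then consider i where "i < n" "y = w ! i" | i where "i < l" "y = (SE i, 1)"
      using D_cases[of x] g_nth g_E by auto
    then show "y \<in> univ ?B" using mem(2) by cases (auto simp: univ_B_struct)
  qed
  then have "partial_iso (beta k l) g ?D ?A ?B"
    using sub fst mono by (intro partial_iso_B_struct)
  moreover have "map g v = w" using g_nth len by (auto intro: nth_equalityI)
  ultimately show thesis using that fst mono by blast
qed

section \<open>Least representatives\<close>

text \<open>Even and odd values keep the two kinds of summand apart, giving one injective numbering
  for all \<open>k\<close> and \<open>l\<close>.\<close>

primrec rank :: "summand \<Rightarrow> nat" where
  "rank (SE i) = 2 * i"
| "rank (ST i) = 2 * i + 1"

text \<open>Summands are compared before positions, so maps that keep the summand and increase
  inside it preserve this order. It is total, for uniqueness of least elements, and well-founded,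
  for their existence.\<close>

definition elem_order :: "((summand \<times> nat) \<times> (summand \<times> nat)) set" where
  "elem_order = inv_image (less_than <*lex*> less_than) (\<lambda>x. (rank (fst x), snd x))"

lemma rank_eq_iff: "rank x = rank y \<longleftrightarrow> x = y"
  by (cases x; cases y) (auto dest: arg_cong[where f = even])

lemma elem_order_iff:
  "(x, y) \<in> elem_order \<longleftrightarrow>
     rank (fst x) < rank (fst y) \<or> fst x = fst y \<and> snd x < snd y"
  by (simp add: elem_order_def rank_eq_iff)

lemma wf_elem_order: "wf elem_order"
  unfolding elem_order_def by (intro wf_inv_image wf_lex_prod wf_less_than)

lemma total_elem_order: "total elem_order"
proof (rule total_onI)
  fix x y :: "summand \<times> nat" assume "x \<noteq> y"
  then show "(x, y) \<in> elem_order \<or> (y, x) \<in> elem_order"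
    by (cases "rank (fst x)" "rank (fst y)" rule: linorder_cases)
       (auto simp: elem_order_iff rank_eq_iff prod_eq_iff)
qed

text \<open>Minimality is taken only among class members satisfying the domain formula, since a
  class may contain other tuples as well. All tuples compared have length \<open>dim I\<close>, as
  \<open>lex\<close> relates only lists of equal length.\<close>

definition least_rep ::
    "(summand \<times> sym, 'r) gscheme \<Rightarrow> (summand \<times> sym, summand \<times> nat) struct
      \<Rightarrow> (summand \<times> nat) list \<Rightarrow> bool" where
  "least_rep I B v \<longleftrightarrow> v \<in> dom_tuples I B \<and>
     (\<forall>w\<in>dom_tuples I B. (v, w) \<in> eq_rel I B \<longrightarrow> (w, v) \<notin> lex elem_order)"

lemma least_rep_exists:
  assumes eq: "equiv (tuples (univ B) (dim I)) (eq_rel I B)" and v: "v \<in> dom_tuples I B"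
  shows "\<exists>w. (v, w) \<in> eq_rel I B \<and> least_rep I B w"
proof -
  have "(v, v) \<in> eq_rel I B"
    using eq v by (auto simp: equiv_def refl_on_def dom_tuples_def)
  then have "v \<in> {w \<in> dom_tuples I B. (v, w) \<in> eq_rel I B}" using v by simp
  from wfE_min[OF wf_lex[OF wf_elem_order] this] obtain w where
    "w \<in> dom_tuples I B" "(v, w) \<in> eq_rel I B"
    "\<And>u. (u, w) \<in> lex elem_order \<Longrightarrow> u \<notin> {w \<in> dom_tuples I B. (v, w) \<in> eq_rel I B}" by blast
  \<comment> \<open>The minimal \<open>w\<close> was found in the class of \<open>v\<close>;
    transitivity makes it minimal in its own class, as \<open>least_rep\<close> demands.\<close>
  moreover have "trans (eq_rel I B)" using eq by (simp add: equiv_def)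
  ultimately show ?thesis unfolding least_rep_def by (blast dest: transD)
qed

lemma lex_total_same_length:
  "length v = length w \<Longrightarrow> total r \<Longrightarrow> v = w \<or> (v, w) \<in> lex r \<or> (w, v) \<in> lex r"
proof (induction rule: list_induct2)
  case (Cons x v y w)
  then show ?case by (cases "x = y") (auto simp: total_on_def)
qed simp

lemma least_rep_unique:
  assumes "equiv (tuples (univ B) (dim I)) (eq_rel I B)"
    and "least_rep I B v" "least_rep I B w" "(v, w) \<in> eq_rel I B"
  shows "v = w"
proof -
  have "(w, v) \<in> eq_rel I B" using assms by (auto simp: equiv_def dest: symD)
  moreover have "length v = length w" using assms by (auto simp: least_rep_def dom_tuples_def tuples_def)
  ultimately show ?thesis
    using lex_total_same_length[OF _ total_elem_order, of v w] assms unfolding least_rep_def by blast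
qed

lemma lex_map:
  assumes "\<And>x y. x \<in> D \<Longrightarrow> y \<in> D \<Longrightarrow> (x, y) \<in> r \<Longrightarrow> (g x, g y) \<in> r"
    and "set v \<subseteq> D" "set w \<subseteq> D" "(v, w) \<in> lex r"
  shows "(map g v, map g w) \<in> lex r"
proof -
  have "length v = length w" using assms(4) by (auto simp: lex_conv)
  then show ?thesis using assms(2-)
    by (induction v w rule: list_induct2) (auto intro: assms(1))
qed

text \<open>A smaller equivalent \<open>u\<close> of \<open>w\<close> in \<open>B\<close> would have
  all its entries in \<open>?D\<close>. The partial isomorphism given by the equal types would then
  carry it to a smaller equivalent of \<open>v\<close> in \<open>A\<close>.\<close>

lemma least_rep_qf_type:
  assumes I: "is_gscheme (beta k l) \<tau> I" "qf_gscheme \<tau> I"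
    and bound: "\<And>B v. B \<in> B_class k l \<Longrightarrow> v \<in> tuples (univ B) (dim I) \<Longrightarrow> card (eq_class I B v) \<le> C"
    and A: "A \<in> B_class k l" "v \<in> tuples (univ A) (dim I)"
    and B: "B \<in> B_class k l" "w \<in> tuples (univ B) (dim I)"
    and tp: "qf_type (beta k l) A v = qf_type (beta k l) B w"
    and least: "least_rep I A v"
  shows "least_rep I B w"
proof -
  obtain N M where NM: "A = B_struct k l N" "B = B_struct k l M"
    using A B by (auto simp: B_class_def)
  let ?D = "set w \<union> {(SE i, 1) | i. i < l}"
  obtain g where g: "partial_iso (beta k l) g ?D B A" "map g w = v"
    and fst: "\<And>x. x \<in> ?D \<Longrightarrow> fst (g x) = fst x"
    and mono: "\<And>x y. \<lbrakk>x \<in> ?D; y \<in> ?D; fst x = fst y; snd x < snd y\<rbrakk> \<Longrightarrow> snd (g x) < snd (g y)"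
    \<comment> \<open>The equality of types is reversed because the tuple to be transferred lives in
      \<open>B\<close>.\<close>
    by (rule qf_type_eq_partial_iso[OF B(2)[unfolded NM] A(2)[unfolded NM]
          tp[unfolded NM, symmetric], folded NM]) blast
  have scheme: "is_scheme (beta k l) \<tau> I" "qf_scheme \<tau> I"
    using I by (auto simp: is_gscheme_def qf_gscheme_def)
  have w: "w \<in> tuples ?D (dim I)" using B(2) by (auto simp: tuples_def)
  have order: "(g x, g y) \<in> elem_order" if "x \<in> ?D" "y \<in> ?D" "(x, y) \<in> elem_order" for x y
    using fst[OF that(1)] fst[OF that(2)] mono[OF that(1,2)] that(3) by (auto simp: elem_order_iff)
  have "w \<in> dom_tuples I B"
    using dom_tuples_partial_iso[OF g(1) scheme w] g(2) least by (simp add: least_rep_def)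
  moreover have "(u, w) \<notin> lex elem_order"
    if u: "u \<in> dom_tuples I B" "(w, u) \<in> eq_rel I B" for u
  proof
    assume uw: "(u, w) \<in> lex elem_order"
    have "set u \<subseteq> ?D"
    proof
      fix x assume x: "x \<in> set u"
      then have "x \<in> univ B" using u(1) by (auto simp: dom_tuples_def tuples_def)
      \<comment> \<open>Elements of the point copies belong to \<open>?D\<close> by construction;
        tournament entries of \<open>u\<close> occur in \<open>w\<close> by the bound on
        classes.\<close>
      then consider i where "i < l" "x = (SE i, 1)" | j a where "x = (ST j, a)"
        unfolding NM univ_B_struct by blast
      then show "x \<in> ?D"
      proof cases
        case (2 j a)
        have "(ST j, a) \<in> set w"
          using tournament_entries_of_equivalent[OF I bound u(2)[unfolded NM]] x 2 by simp
        then show ?thesis using 2 by simp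
      qed simp
    qed
    then have u': "u \<in> tuples ?D (dim I)" using u(1) by (auto simp: dom_tuples_def tuples_def)
    have "map g u \<in> dom_tuples I A"
      using dom_tuples_partial_iso[OF g(1) scheme u'] u(1) by simp
    moreover have "(v, map g u) \<in> eq_rel I A"
      using eq_rel_partial_iso[OF g(1) I w u'] g(2) u(2) by simp
    moreover have "(map g u, v) \<in> lex elem_order"
      using lex_map[of ?D elem_order g u w] order \<open>set u \<subseteq> ?D\<close> uw g(2) by blast
    ultimately show False using least by (auto simp: least_rep_def)
  qed
  ultimately show ?thesis by (simp add: least_rep_def)
qed

text \<open>The domain of \<open>J\<close> contains exactly one member of each class that meets the
  domain of \<open>I\<close>. Sending a class to that member is the isomorphism, and compatibility
  of the relation formulas makes it respect the relations.\<close>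

lemma isomorphic_representatives:
  assumes I: "is_gscheme \<kappa> \<tau> I" "qf_gscheme \<tau> I" and B: "is_struct \<kappa> B"
    and J: "dim J = dim I" "rel_fm J = rel_fm I" "dom_tuples J B \<subseteq> dom_tuples I B"
    and ex: "\<And>v. v \<in> dom_tuples I B \<Longrightarrow> \<exists>w\<in>dom_tuples J B. (v, w) \<in> eq_rel I B"
    and unique: "\<And>v w. \<lbrakk>v \<in> dom_tuples J B; w \<in> dom_tuples J B; (v, w) \<in> eq_rel I B\<rbrakk> \<Longrightarrow> v = w"
  shows "isomorphic \<tau> (interpret_gscheme \<tau> I B) (interpret_scheme \<tau> J B)"
proof -
  note eq = is_gscheme_struct(1)[OF I B]
  have eq_sym: "(v, w) \<in> eq_rel I B \<Longrightarrow> (w, v) \<in> eq_rel I B" for v w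
    using eq by (auto simp: equiv_def dest: symD)
  have class_eq: "eq_class I B v = eq_class I B w \<longleftrightarrow> (v, w) \<in> eq_rel I B"
    if "v \<in> dom_tuples I B" "w \<in> dom_tuples I B" for v w
    using eq_equiv_class_iff[OF eq] that by (simp add: dom_tuples_def)
  define f where "f X = (SOME w. w \<in> dom_tuples J B \<and> w \<in> X)" for X
  have f: "f (eq_class I B v) \<in> dom_tuples J B \<and> (v, f (eq_class I B v)) \<in> eq_rel I B"
    if v: "v \<in> dom_tuples I B" for v
  proof -
    have "\<exists>w. w \<in> dom_tuples J B \<and> w \<in> eq_class I B v" using ex[OF v] by auto
    from someI_ex[OF this] show ?thesis by (simp add: f_def)
  qed
  have f_J: "f (eq_class I B v) = v" if "v \<in> dom_tuples J B" for v
    using f[of v] unique[OF that, of "f (eq_class I B v)"] that J(3) by auto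
  have "bij_betw f (eq_class I B ` dom_tuples I B) (dom_tuples J B)"
    unfolding bij_betw_def
  proof
    show "inj_on f (eq_class I B ` dom_tuples I B)"
    proof (rule inj_onI, clarify)
      fix v w assume vw: "v \<in> dom_tuples I B" "w \<in> dom_tuples I B"
        "f (eq_class I B v) = f (eq_class I B w)"
      then have "(v, f (eq_class I B v)) \<in> eq_rel I B" "(f (eq_class I B v), w) \<in> eq_rel I B"
        using f eq_sym by metis+
      then have "(v, w) \<in> eq_rel I B" using eq unfolding equiv_def by (blast dest: transD)
      then show "eq_class I B v = eq_class I B w" using class_eq vw by simp
    qed
    show "f ` eq_class I B ` dom_tuples I B = dom_tuples J B"
      using f f_J J(3) by (auto simp: image_iff) (metis subsetD)
  qed
  moreover have "Xs \<in> rel (interpret_gscheme \<tau> I B) r \<longleftrightarrow> map f Xs \<in> rel (interpret_scheme \<tau> J B) r"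
    if r: "r \<in> syms \<tau>" and Xs: "Xs \<in> tuples (eq_class I B ` dom_tuples I B) (ar \<tau> r)" for r Xs
  proof -
    have mem: "map f Xs \<in> tuples (dom_tuples J B) (ar \<tau> r)"
      using Xs f by (intro map_tuples[of f]) auto
    have class_f: "eq_class I B (f X) = X" if X: "X \<in> set Xs" for X
    proof -
      obtain v where v: "v \<in> dom_tuples I B" "X = eq_class I B v"
        using Xs X by (auto simp: tuples_def)
      then show ?thesis using f[OF v(1)] class_eq J(3) by auto
    qed
    show ?thesis
    proof
      assume "Xs \<in> rel (interpret_gscheme \<tau> I B) r"
      then obtain vs where vs: "vs \<in> tuples (dom_tuples I B) (ar \<tau> r)"
        "holds B (rel_fm I r) (concat vs)" "Xs = map (eq_class I B) vs"
        by (auto simp: interpret_gscheme_def)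
      \<comment> \<open>The tuples \<open>vs\<close> witnessing the relation on classes need not be
        the chosen representatives, but they are equivalent to them entry by entry, so compatibility
        applies.\<close>
      have "(vs ! i, map f Xs ! i) \<in> eq_rel I B" if "i < ar \<tau> r" for i
      proof -
        have "vs ! i \<in> dom_tuples I B" "i < length vs" using vs(1) that by (auto simp: tuples_def)
        then show ?thesis using f vs(3) by simp
      qed
      then have "holds B (rel_fm I r) (concat (map f Xs))"
        using is_gscheme_struct(2)[OF I B r, of vs "map f Xs"] vs Xs by (auto simp: tuples_def)
      then show "map f Xs \<in> rel (interpret_scheme \<tau> J B) r"
        using mem J by (simp add: interpret_scheme_def)
    next
      assume "map f Xs \<in> rel (interpret_scheme \<tau> J B) r"
      then have "holds B (rel_fm I r) (concat (map f Xs))"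
        using J by (simp add: interpret_scheme_def)
      moreover have "map f Xs \<in> tuples (dom_tuples I B) (ar \<tau> r)"
        using mem J(3) tuples_mono by blast
      \<comment> \<open>The representatives lie in the domain of \<open>I\<close> and themselves
        witness the relation on their classes.\<close>
      ultimately have "map (eq_class I B) (map f Xs) \<in> rel (interpret_gscheme \<tau> I B) r"
        unfolding interpret_gscheme_def struct.select_convs by (intro imageI) simp
      moreover have "map (eq_class I B) (map f Xs) = Xs"
        using class_f by (simp add: map_idI)
      ultimately show "Xs \<in> rel (interpret_gscheme \<tau> I B) r" by simp
    qed
  qed
  ultimately show ?thesis
    unfolding isomorphic_def
    by (intro exI[of _ f]) (simp add: interpret_gscheme_def interpret_scheme_def)
qed

theorem theorem8p2:
  fixes k l :: nat
    and \<tau> :: "'r signature"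
    and I :: "(summand \<times> sym, 'r) gscheme"
  assumes "is_signature \<tau>"
    and "is_gscheme (beta k l) \<tau> I"
    and "qf_gscheme \<tau> I"
    and "\<exists>N. \<forall>B\<in>B_class k l. \<forall>v\<in>tuples (univ B) (dim I). card (eq_class I B v) \<le> N"
  shows "\<exists>\<rho>. formula (beta k l) (dim I) \<rho> \<and> qf \<rho> \<and>
           (let J = \<lparr>dim = dim I, dom_fm = \<rho>, rel_fm = rel_fm I\<rparr>
            in is_scheme (beta k l) \<tau> J \<and> qf_scheme \<tau> J \<and>
               (\<forall>B\<in>B_class k l.
                  isomorphic \<tau> (interpret_gscheme \<tau> I B) (interpret_scheme \<tau> J B)))"
proof -
  note I = assms(2,3)
  obtain C where "\<And>B v. B \<in> B_class k l \<Longrightarrow> v \<in> tuples (univ B) (dim I) \<Longrightarrow> card (eq_class I B v) \<le> C"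
    using assms(4) by blast
  note inv = least_rep_qf_type[OF I this]
  obtain \<rho> where \<rho>: "qf \<rho>" "formula (beta k l) (dim I) \<rho>"
    "\<And>B v. B \<in> B_class k l \<Longrightarrow> v \<in> tuples (univ B) (dim I) \<Longrightarrow> holds B \<rho> v \<longleftrightarrow> least_rep I B v"
    using qf_type_invariant_definable[OF is_signature_beta, of "B_class k l" "dim I" k l "least_rep I"]
      inv by metis
  define J where "J = \<lparr>dim = dim I, dom_fm = \<rho>, rel_fm = rel_fm I\<rparr>"
  have "isomorphic \<tau> (interpret_gscheme \<tau> I B) (interpret_scheme \<tau> J B)" if B: "B \<in> B_class k l" for B
  proof -
    note struct = is_struct_B_class[OF B]
    note eq = is_gscheme_struct(1)[OF I struct]
    \<comment> \<open>The formula is correct only on tuples over the domain of length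
      \<open>dim I\<close>; both sides imply that \<open>v\<close> is such a tuple, so the
      equivalence holds for every list.\<close>
    have dom: "v \<in> dom_tuples J B \<longleftrightarrow> least_rep I B v" for v
      using \<rho>(3)[OF B] by (auto simp: dom_tuples_def J_def least_rep_def)
    show ?thesis
    proof (rule isomorphic_representatives[OF I struct])
      show "dom_tuples J B \<subseteq> dom_tuples I B" using dom by (auto simp: least_rep_def)
      show "\<exists>w\<in>dom_tuples J B. (v, w) \<in> eq_rel I B" if "v \<in> dom_tuples I B" for v
        using least_rep_exists[OF eq that] dom by blast
    qed (use dom least_rep_unique[OF eq] in \<open>auto simp: J_def\<close>)
  qed
  moreover have "is_scheme (beta k l) \<tau> J" "qf_scheme \<tau> J"
    using I \<rho> by (auto simp: is_gscheme_def is_scheme_def qf_gscheme_def qf_scheme_def J_def)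
  ultimately show ?thesis using \<rho>(1,2) unfolding J_def Let_def by blast
qed

end
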